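(* Let $\Theta,K\in\operatorname{End}_{\mathcal A}^*(\mathcal H)$ and let $\{\Upsilon_\xi\in\operatorname{End}_{\mathcal A}^*(\mathcal H,\mathcal H_\xi)\}_{\xi\in\Omega}$ be a $\delta$-tight c-$K$-g-frame for $\mathcal H$. Suppose that $\Theta K=K\Theta$ and that $K^*$ is bounded below. Then the following assertions are equivalent: (i) $\Theta$ is surjective. (ii) $\{\Upsilon_\xi\Theta^*\}_{\xi\in\Omega}$ is a c-$K$-g-frame for $\mathcal H$.
   Context: Standing setting: $\mathcal A$ is a unital $C^*$-algebra, $(\Omega,\nu)$ is a measure space, $\mathcal H$ and $\mathcal K$ are Hilbert $\mathcal A$-modules (with $\mathcal A$-valued inner products $\langle\cdot,\cdot\rangle$, linear in the first variable, and norm $\|x\|=\|\langle x,x\rangle\|^{1/2}$), and $\{\mathcal H_\xi\}_{\xi\in\Omega}$ is a family of (closed sub)modules of $\mathcal K$. $\operatorname{End}_{\mathcal A}^*(\mathcal E,\mathcal F)$ is the set of adjointable $\mathcal A$-linear maps $\mathcal E\to\mathcal F$, and $\operatorname{End}_{\mathcal A}^*(\mathcal E)=\operatorname{End}_{\mathcal A}^*(\mathcal E,\mathcal E)$. Inequalities between elements of $\mathcal A$ are in the order of the $C^*$-algebra. For $K\in\operatorname{End}_{\mathcal A}^*(\mathcal H)$, a family $\{\Upsilon_\xi\in\operatorname{End}_{\mathcal A}^*(\mathcal H,\mathcal H_\xi)\}_{\xi\in\Omega}$ is a c-$K$-g-frame (continuous $K$-g-frame) for $\mathcal H$ with respect to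 $\{\mathcal H_\xi\}_{\xi\in\Omega}$ if (a) for every $h\in\mathcal H$ the function $\xi\mapsto\Upsilon_\xi h$ is measurable, and (b) there exist constants $0<A\le B<\infty$ such that for all $h\in\mathcal H$: $A\langle K^*h,K^*h\rangle\le\int_\Omega\langle\Upsilon_\xi h,\Upsilon_\xi h\rangle\,\mathrm d\nu(\xi)\le B\langle h,h\rangle$. It is $\delta$-tight ($\delta>0$) if $\delta\langle K^*h,K^*h\rangle=\int_\Omega\langle\Upsilon_\xi h,\Upsilon_\xi h\rangle\,\mathrm d\nu(\xi)$ for all $h\in\mathcal H$. $K^*$ is bounded below if there is $m>0$ with $\|K^*x\|\ge m\|x\|$ for all $x\in\mathcal H$ (equivalently, there is $m'>0$ with $\langle K^*x,K^*x\rangle\ge m'\langle x,x\rangle$ for all $x\in\mathcal H$). *)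

theory Defs
  imports "HOL-Analysis.Analysis"
begin

section \<open>Unital C*-algebras\<close>

class cstar_algebra = real_normed_algebra_1 + banach +
  fixes scaleC :: "complex \<Rightarrow> 'a \<Rightarrow> 'a" (infixr "*\<^sub>C" 75)
    and star :: "'a \<Rightarrow> 'a"
  assumes scaleC_add_right: "c *\<^sub>C (x + y) = c *\<^sub>C x + c *\<^sub>C y"
    and scaleC_add_left: "(c + d) *\<^sub>C x = c *\<^sub>C x + d *\<^sub>C x"
    and scaleC_scaleC: "c *\<^sub>C d *\<^sub>C x = (c * d) *\<^sub>C x"
    and scaleC_of_real: "complex_of_real r *\<^sub>C x = r *\<^sub>R x"
    and mult_scaleC_left: "(c *\<^sub>C x) * y = c *\<^sub>C (x * y)"
    and mult_scaleC_right: "x * (c *\<^sub>C y) = c *\<^sub>C (x * y)"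
    and norm_scaleC: "norm (c *\<^sub>C x) = cmod c * norm x"
    and star_add: "star (x + y) = star x + star y"
    and star_scaleC: "star (c *\<^sub>C x) = cnj c *\<^sub>C star x"
    and star_mult: "star (x * y) = star y * star x"
    and star_star: "star (star x) = x"
    and cstar_identity: "norm (star x * x) = (norm x)\<^sup>2"

definition cstar_spectrum :: "'a::cstar_algebra \<Rightarrow> complex set" where
  "cstar_spectrum a =
    {z. \<not> (\<exists>b. b * (z *\<^sub>C 1 - a) = 1 \<and> (z *\<^sub>C 1 - a) * b = 1)}"

definition cstar_positive :: "'a::cstar_algebra \<Rightarrow> bool" where
  "cstar_positive a \<longleftrightarrow> star a = a \<and> cstar_spectrum a \<subseteq> \<real>\<^sub>\<ge>\<^sub>0"

definition cstar_le :: "'a::cstar_algebra \<Rightarrow> 'a \<Rightarrow> bool" (infix "\<preceq>" 50) where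
  "a \<preceq> b \<longleftrightarrow> cstar_positive (b - a)"

section \<open>Hilbert modules\<close>

text \<open>
  Left modules with an inner product that is linear in the first variable.  Completeness is
  part of the sort \<^class>\<open>banach\<close>.  The algebra being unital, the complex vector space
  structure is the action of the elements \<open>z *\<^sub>C 1\<close>; \<open>sm_scaleR\<close> makes the real scalars of
  the type agree with it.
\<close>

locale hilbert_module =
  fixes sm :: "'a::cstar_algebra \<Rightarrow> 'h::banach \<Rightarrow> 'h"
    and ip :: "'h \<Rightarrow> 'h \<Rightarrow> 'a"
  assumes sm_add_right: "sm a (x + y) = sm a x + sm a y"
    and sm_add_left: "sm (a + b) x = sm a x + sm b x"
    and sm_mult: "sm (a * b) x = sm a (sm b x)"
    and sm_one: "sm 1 x = x"
    and sm_scaleR: "sm (r *\<^sub>R 1) x = r *\<^sub>R x"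
    and ip_add_left: "ip (x + y) z = ip x z + ip y z"
    and ip_sm_left: "ip (sm a x) y = a * ip x y"
    and ip_star: "star (ip x y) = ip y x"
    and ip_positive: "cstar_positive (ip x x)"
    and ip_definite: "ip x x = 0 \<Longrightarrow> x = 0"
    and norm_eq_sqrt_ip: "norm x = sqrt (norm (ip x x))"

definition closed_submodule :: "('a \<Rightarrow> 'k \<Rightarrow> 'k::banach) \<Rightarrow> 'k set \<Rightarrow> bool" where
  "closed_submodule sm F \<longleftrightarrow>
    closed F \<and> 0 \<in> F \<and> (\<forall>x\<in>F. \<forall>y\<in>F. x + y \<in> F) \<and> (\<forall>a. \<forall>x\<in>F. sm a x \<in> F)"

text \<open>
  \<open>adjointable smH ipH smK ipK F T\<close>: \<open>T\<close> is an adjointable module map from the whole module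
  \<open>(smH, ipH)\<close> to the submodule \<open>F\<close> of \<open>(smK, ipK)\<close>; the adjoint is only required on \<open>F\<close>, so
  its values outside \<open>F\<close> are irrelevant.
\<close>

definition adjointable ::
  "('a \<Rightarrow> 'h \<Rightarrow> 'h) \<Rightarrow> ('h \<Rightarrow> 'h \<Rightarrow> 'a) \<Rightarrow> ('a \<Rightarrow> 'k \<Rightarrow> 'k) \<Rightarrow> ('k \<Rightarrow> 'k \<Rightarrow> 'a)
    \<Rightarrow> 'k set \<Rightarrow> ('h::banach \<Rightarrow> 'k::banach) \<Rightarrow> bool" where
  "adjointable smH ipH smK ipK F T \<longleftrightarrow>
    (\<forall>x y. T (x + y) = T x + T y) \<and> (\<forall>a x. T (smH a x) = smK a (T x)) \<and>
    range T \<subseteq> F \<and> (\<exists>S. \<forall>x. \<forall>y\<in>F. ipK (T x) y = ipH x (S y))"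

abbreviation adjointable_endo ::
  "('a \<Rightarrow> 'h \<Rightarrow> 'h) \<Rightarrow> ('h \<Rightarrow> 'h \<Rightarrow> 'a) \<Rightarrow> ('h::banach \<Rightarrow> 'h) \<Rightarrow> bool" where
  "adjointable_endo sm ip T \<equiv> adjointable sm ip sm ip UNIV T"

definition module_adjoint :: "('h \<Rightarrow> 'h \<Rightarrow> 'a) \<Rightarrow> ('h \<Rightarrow> 'h) \<Rightarrow> 'h \<Rightarrow> 'h" where
  "module_adjoint ip T = (THE S. \<forall>x y. ip (T x) y = ip x (S y))"

definition bounded_below :: "('h::real_normed_vector \<Rightarrow> 'h) \<Rightarrow> bool" where
  "bounded_below T \<longleftrightarrow> (\<exists>m>0. \<forall>x. norm (T x) \<ge> m * norm x)"

section \<open>Bochner integral in arbitrary normed spaces\<close>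

text \<open>
  \<^const>\<open>has_bochner_integral\<close> demands a second countable (that is, separable) codomain, which
  a C*-algebra need not be.  This is the same definition without that sort constraint.
\<close>

definition has_banach_integral ::
  "'w measure \<Rightarrow> ('w \<Rightarrow> 'b::real_normed_vector) \<Rightarrow> 'b \<Rightarrow> bool" where
  "has_banach_integral M f I \<longleftrightarrow> f \<in> borel_measurable M \<and>
    (\<exists>s. (\<forall>i. Bochner_Integration.simple_bochner_integrable M (s i)) \<and>
      (\<lambda>i. \<integral>\<^sup>+x. norm (f x - s i x) \<partial>M) \<longlonglongrightarrow> 0 \<and>
      (\<lambda>i. Bochner_Integration.simple_bochner_integral M (s i)) \<longlonglongrightarrow> I)"

lemma has_banach_integral_iff_has_bochner_integral:
  fixes f :: "'w \<Rightarrow> 'b::{real_normed_vector, second_countable_topology}"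
  shows "has_banach_integral M f I \<longleftrightarrow> has_bochner_integral M f I"
  unfolding has_banach_integral_def has_bochner_integral.simps by blast

section \<open>Continuous K-g-frames\<close>

text \<open>
  The index set \<open>\<Omega>\<close> is \<open>space M\<close>; \<open>\<Upsilon>\<close> and \<open>Hs\<close> are unconstrained outside it.  The existence of
  the integral is part of the frame condition.
\<close>

definition cKg_frame ::
  "'w measure \<Rightarrow> ('a::cstar_algebra \<Rightarrow> 'h \<Rightarrow> 'h) \<Rightarrow> ('h \<Rightarrow> 'h \<Rightarrow> 'a)
    \<Rightarrow> ('a \<Rightarrow> 'k \<Rightarrow> 'k) \<Rightarrow> ('k \<Rightarrow> 'k \<Rightarrow> 'a) \<Rightarrow> ('w \<Rightarrow> 'k set)
    \<Rightarrow> ('h::banach \<Rightarrow> 'h) \<Rightarrow> ('w \<Rightarrow> 'h \<Rightarrow> 'k::banach) \<Rightarrow> bool" where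
  "cKg_frame M smH ipH smK ipK Hs K \<Upsilon> \<longleftrightarrow>
    (\<forall>\<xi>\<in>space M. adjointable smH ipH smK ipK (Hs \<xi>) (\<Upsilon> \<xi>)) \<and>
    (\<forall>h. (\<lambda>\<xi>. \<Upsilon> \<xi> h) \<in> borel_measurable M) \<and>
    (\<exists>A B::real. 0 < A \<and> A \<le> B \<and>
      (\<forall>h. \<exists>I. has_banach_integral M (\<lambda>\<xi>. ipK (\<Upsilon> \<xi> h) (\<Upsilon> \<xi> h)) I \<and>
        A *\<^sub>R ipH (module_adjoint ipH K h) (module_adjoint ipH K h) \<preceq> I \<and>
        I \<preceq> B *\<^sub>R ipH h h))"

definition tight_cKg_frame ::
  "real \<Rightarrow> 'w measure \<Rightarrow> ('a::cstar_algebra \<Rightarrow> 'h \<Rightarrow> 'h) \<Rightarrow> ('h \<Rightarrow> 'h \<Rightarrow> 'a)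
    \<Rightarrow> ('a \<Rightarrow> 'k \<Rightarrow> 'k) \<Rightarrow> ('k \<Rightarrow> 'k \<Rightarrow> 'a) \<Rightarrow> ('w \<Rightarrow> 'k set)
    \<Rightarrow> ('h::banach \<Rightarrow> 'h) \<Rightarrow> ('w \<Rightarrow> 'h \<Rightarrow> 'k::banach) \<Rightarrow> bool" where
  "tight_cKg_frame \<delta> M smH ipH smK ipK Hs K \<Upsilon> \<longleftrightarrow>
    cKg_frame M smH ipH smK ipK Hs K \<Upsilon> \<and> \<delta> > 0 \<and>
    (\<forall>h. has_banach_integral M (\<lambda>\<xi>. ipK (\<Upsilon> \<xi> h) (\<Upsilon> \<xi> h))
      (\<delta> *\<^sub>R ipH (module_adjoint ipH K h) (module_adjoint ipH K h)))"

end

theory Submission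
  imports Defs
begin

text \<open>
  By tightness and uniqueness of the integral, the frame integral of \<open>\<Upsilon>\<^sub>\<xi> \<Theta>*\<close> is
  \<open>\<delta>\<langle>K*\<Theta>*h, K*\<Theta>*h\<rangle> = \<delta>\<langle>\<Theta>*K*h, \<Theta>*K*h\<rangle>\<close>.  If \<open>\<Theta>\<close> is surjective, uniform boundedness makes \<open>\<Theta>*\<close>
  bounded below, hence \<open>P = \<Theta>\<Theta>*\<close> invertible; since \<open>y = (P\<^sup>-\<^sup>1\<Theta>)\<Theta>*y\<close> and \<open>\<langle>Vx, Vx\<rangle> \<le> C\<langle>x, x\<rangle>\<close> for
  adjointable \<open>V\<close>, this yields \<open>\<langle>y, y\<rangle> \<le> C\<langle>\<Theta>*y, \<Theta>*y\<rangle>\<close> and so the lower frame bound.  Conversely, the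
  lower frame bound and monotonicity of the norm on positive elements make \<open>\<Theta>*\<close> bounded below, so
  that \<open>\<Theta>\<Theta>*\<close> is surjective.  No functional calculus in \<open>\<A>\<close> is needed: differences of inner squares
  are shown to be positive by writing them as inner squares, via square roots of operators near
  the identity.
\<close>

section \<open>Uniqueness of the Bochner integral\<close>

text \<open>The integrals of simple functions \<open>s\<close> and \<open>t\<close> differ in norm
  by at most the sum of their L1 distances to \<open>f\<close>, and this sum tends to 0 along two
  approximating sequences.\<close>

lemma has_banach_integral_unique:
  fixes f :: "'w \<Rightarrow> 'b::real_normed_vector"
  assumes "has_banach_integral M f I" "has_banach_integral M f J"
  shows "I = J"
proof -
  have f: "f \<in> borel_measurable M"
    using assms(1) by (simp add: has_banach_integral_def)
  \<comment> \<open>In a nonseparable space a difference of measurable functions need not be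
    measurable. Since \<open>s\<close> has finite range, the functions \<open>norm (f x - c)\<close>
    with constant \<open>c\<close> can be glued along the fibres of \<open>s\<close>.\<close>
  have meas: "(\<lambda>x. ennreal (norm (f x - s x))) \<in> borel_measurable M"
    if "Bochner_Integration.simple_bochner_integrable M s" for s
  proof -
    have sf: "simple_function M s"
      using that by (auto elim: simple_bochner_integrable.cases)
    have "(\<lambda>x. norm (f x - c)) \<in> borel_measurable M" for c
      by (rule measurable_compose[OF f], rule borel_measurable_continuous_onI)
        (intro continuous_intros)
    moreover have "s \<in> measurable M (count_space (s ` space M))"
      using measurable_simple_function[OF sf] by (auto simp: measurable_def)
    moreover have "countable (s ` space M)"
      using sf by (simp add: simple_function_def countable_finite)
    ultimately have "(\<lambda>x. norm (f x - s x)) \<in> borel_measurable M"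
      by (rule measurable_compose_countable'[where f = "\<lambda>c x. norm (f x - c)"])
    then show ?thesis by measurable
  qed
  have bound: "ennreal (norm (Bochner_Integration.simple_bochner_integral M s - Bochner_Integration.simple_bochner_integral M t))
      \<le> (\<integral>\<^sup>+x. norm (f x - s x) \<partial>M) + (\<integral>\<^sup>+x. norm (f x - t x) \<partial>M)"
    if s: "Bochner_Integration.simple_bochner_integrable M s" and t: "Bochner_Integration.simple_bochner_integrable M t" for s t
  proof -
    have "norm (Bochner_Integration.simple_bochner_integral M s - Bochner_Integration.simple_bochner_integral M t)
        = norm (Bochner_Integration.simple_bochner_integral M (\<lambda>x. s x - t x))"
      by (simp add: simple_bochner_integral_diff[OF s t])
    also have "\<dots> \<le> Bochner_Integration.simple_bochner_integral M (\<lambda>x. norm (s x - t x))"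
      using simple_bochner_integrable_compose2[of "(-)", OF _ s t]
      by (intro simple_bochner_integral_norm_bound) auto
    finally have "ennreal (norm (Bochner_Integration.simple_bochner_integral M s - Bochner_Integration.simple_bochner_integral M t))
        \<le> ennreal (Bochner_Integration.simple_bochner_integral M (\<lambda>x. norm (s x - t x)))"
      by (rule ennreal_leI)
    also have "\<dots> = (\<integral>\<^sup>+x. norm (s x - t x) \<partial>M)"
      using simple_bochner_integrable_compose2[of "\<lambda>x y. norm (x - y)", OF _ s t]
      by (intro simple_bochner_integral_eq_nn_integral) auto
    also have "\<dots> \<le> (\<integral>\<^sup>+x. ennreal (norm (f x - s x)) + ennreal (norm (f x - t x)) \<partial>M)"
    proof (intro nn_integral_mono)
      fix x
      have "norm (s x - t x) \<le> norm (f x - s x) + norm (f x - t x)"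
        by (metis norm_diff_triangle_le norm_minus_commute order_refl)
      then show "ennreal (norm (s x - t x)) \<le> ennreal (norm (f x - s x)) + ennreal (norm (f x - t x))"
        by (metis ennreal_leI ennreal_plus norm_ge_zero)
    qed
    also have "\<dots> = (\<integral>\<^sup>+x. norm (f x - s x) \<partial>M) + (\<integral>\<^sup>+x. norm (f x - t x) \<partial>M)"
      by (intro nn_integral_add meas s t)
    finally show ?thesis .
  qed
  obtain s where s: "\<And>i. Bochner_Integration.simple_bochner_integrable M (s i)"
      "(\<lambda>i. \<integral>\<^sup>+x. norm (f x - s i x) \<partial>M) \<longlonglongrightarrow> 0"
      "(\<lambda>i. Bochner_Integration.simple_bochner_integral M (s i)) \<longlonglongrightarrow> I"
    using assms(1) unfolding has_banach_integral_def by blast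
  obtain t where t: "\<And>i. Bochner_Integration.simple_bochner_integrable M (t i)"
      "(\<lambda>i. \<integral>\<^sup>+x. norm (f x - t i x) \<partial>M) \<longlonglongrightarrow> 0"
      "(\<lambda>i. Bochner_Integration.simple_bochner_integral M (t i)) \<longlonglongrightarrow> J"
    using assms(2) unfolding has_banach_integral_def by blast
  have "(\<lambda>i. ennreal (norm (Bochner_Integration.simple_bochner_integral M (s i) - Bochner_Integration.simple_bochner_integral M (t i))))
      \<longlonglongrightarrow> ennreal (norm (I - J))"
    by (intro tendsto_intros s t)
  moreover have "(\<lambda>i. ennreal (norm (Bochner_Integration.simple_bochner_integral M (s i) - Bochner_Integration.simple_bochner_integral M (t i))))
      \<longlonglongrightarrow> 0"
  proof (rule tendsto_sandwich[OF _ _ tendsto_const])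
    show "\<forall>\<^sub>F i in sequentially. ennreal (norm (Bochner_Integration.simple_bochner_integral M (s i) - Bochner_Integration.simple_bochner_integral M (t i)))
        \<le> (\<integral>\<^sup>+x. norm (f x - s i x) \<partial>M) + (\<integral>\<^sup>+x. norm (f x - t i x) \<partial>M)"
      by (intro always_eventually allI bound s t)
    show "(\<lambda>i. (\<integral>\<^sup>+x. norm (f x - s i x) \<partial>M) + (\<integral>\<^sup>+x. norm (f x - t i x) \<partial>M)) \<longlonglongrightarrow> 0"
      using tendsto_add[OF s(2) t(2)] by simp
  qed simp
  ultimately have "ennreal (norm (I - J)) = 0"
    by (rule LIMSEQ_unique)
  then show ?thesis
    by (simp add: ennreal_eq_0_iff)
qed

section \<open>Binomial estimates\<close>

text \<open>Pascal's rule under the sum; it drives the inductions on binomial sums below.\<close>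

lemma sum_binomial_Suc:
  fixes f :: "nat \<Rightarrow> 'a::real_vector"
  shows "(\<Sum>k\<le>Suc n. real (Suc n choose k) *\<^sub>R f k)
    = (\<Sum>k\<le>n. real (n choose k) *\<^sub>R (f k + f (Suc k)))"
proof -
  have "(\<Sum>k\<le>Suc n. real (Suc n choose k) *\<^sub>R f k)
      = f 0 + (\<Sum>k\<le>n. real (n choose Suc k) *\<^sub>R f (Suc k)) + (\<Sum>k\<le>n. real (n choose k) *\<^sub>R f (Suc k))"
    by (subst sum.atMost_Suc_shift) (simp add: scaleR_left_distrib sum.distrib add.commute)
  also have "f 0 + (\<Sum>k\<le>n. real (n choose Suc k) *\<^sub>R f (Suc k))
      = (\<Sum>k\<le>Suc n. real (n choose k) *\<^sub>R f k)"
    by (subst sum.atMost_Suc_shift) simp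
  also have "\<dots> = (\<Sum>k\<le>n. real (n choose k) *\<^sub>R f k)"
    by simp
  finally show ?thesis
    by (simp add: scaleR_right_distrib sum.distrib)
qed

text \<open>Divided by \<open>2 ^ n\<close>, this is the variance of a sum of \<open>n\<close>
  independent random signs, whose value is \<open>n - 2 * k\<close> when \<open>k\<close> of them
  are negative.\<close>

lemma binomial_second_moment:
  "(\<Sum>k\<le>n. real (n choose k) * (real n - 2 * real k)\<^sup>2) = real n * 2 ^ n"
proof (induction n)
  case (Suc n)
  have "(\<Sum>k\<le>Suc n. real (Suc n choose k) * (real (Suc n) - 2 * real k)\<^sup>2)
      = (\<Sum>k\<le>n. real (n choose k) *
          ((real (Suc n) - 2 * real k)\<^sup>2 + (real (Suc n) - 2 * real (Suc k))\<^sup>2))"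
    using sum_binomial_Suc[of n "\<lambda>k. (real (Suc n) - 2 * real k)\<^sup>2"] by simp
  also have "\<dots> = (\<Sum>k\<le>n. 2 * (real (n choose k) * (real n - 2 * real k)\<^sup>2) + 2 * real (n choose k))"
    by (intro sum.cong) (auto simp: power2_eq_square algebra_simps)
  also have "\<dots> = 2 * (real n * 2 ^ n) + 2 * (\<Sum>k\<le>n. real (n choose k))"
    by (simp only: sum.distrib Suc.IH flip: sum_distrib_left)
  also have "(\<Sum>k\<le>n. real (n choose k)) = 2 ^ n"
    by (simp flip: of_nat_sum add: choose_row_sum)
  finally show ?case
    by (simp add: algebra_simps)
qed simp

text \<open>The inequality r|d| <= (r^2 + d^2)/2 reduces this to the second moment. The choice r =
  sqrt n balances the two terms, since the mean of d^2 is n.\<close>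

lemma binomial_first_absolute_moment:
  "(\<Sum>k\<le>n. real (n choose k) * \<bar>real n - 2 * real k\<bar>) \<le> sqrt (real n) * 2 ^ n"
proof (cases "n = 0")
  case False
  define r where "r = sqrt (real n)"
  have r: "r > 0" "r * r = real n"
    using False by (auto simp: r_def)
  have "r * (\<Sum>k\<le>n. real (n choose k) * \<bar>real n - 2 * real k\<bar>)
      = (\<Sum>k\<le>n. real (n choose k) * (r * \<bar>real n - 2 * real k\<bar>))"
    by (simp add: sum_distrib_left mult.left_commute)
  also have "\<dots> \<le> (\<Sum>k\<le>n. real (n choose k) * ((real n + (real n - 2 * real k)\<^sup>2) / 2))"
  proof (intro sum_mono mult_left_mono)
    fix k
    have "0 \<le> (r - \<bar>real n - 2 * real k\<bar>)\<^sup>2"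
      by simp
    then show "r * \<bar>real n - 2 * real k\<bar> \<le> (real n + (real n - 2 * real k)\<^sup>2) / 2"
      by (simp only: power2_diff power2_abs power2_eq_square[of r] r) simp
  qed simp
  also have "\<dots> = (\<Sum>k\<le>n. real n / 2 * real (n choose k) + real (n choose k) * (real n - 2 * real k)\<^sup>2 / 2)"
    by (intro sum.cong) (auto simp: field_simps)
  also have "\<dots> = real n / 2 * (\<Sum>k\<le>n. real (n choose k)) + (real n * 2 ^ n) / 2"
    by (simp only: sum.distrib binomial_second_moment flip: sum_distrib_left sum_divide_distrib)
  also have "(\<Sum>k\<le>n. real (n choose k)) = 2 ^ n"
    by (simp flip: of_nat_sum add: choose_row_sum)
  finally have "r * (\<Sum>k\<le>n. real (n choose k) * \<bar>real n - 2 * real k\<bar>) \<le> r * (r * 2 ^ n)"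
    by (simp add: r(2) flip: mult.assoc)
  then show ?thesis
    using r(1) by (simp add: r_def)
qed simp

section \<open>Binomial expansions in a normed algebra\<close>

lemma one_plus_power_eq_sum:
  fixes c :: "'a::real_algebra_1"
  shows "(1 + c) ^ n = (\<Sum>k\<le>n. real (n choose k) *\<^sub>R c ^ k)"
proof (induction n)
  case (Suc n)
  have "(1 + c) ^ Suc n = (\<Sum>k\<le>n. real (n choose k) *\<^sub>R c ^ k) * (1 + c)"
    by (simp only: power_Suc2 Suc)
  also have "\<dots> = (\<Sum>k\<le>n. real (n choose k) *\<^sub>R (c ^ k + c ^ Suc k))"
    by (simp add: sum_distrib_right distrib_left scaleR_right_distrib power_commutes sum.distrib)
  finally show ?case
    by (simp only: sum_binomial_Suc)
qed simp

text \<open>With N = n + 1, the coefficient of \<open>c ^ k\<close> on the left is N times the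
  difference of the binomial coefficients (n choose k) and (n choose k-1), which equals (N choose
  k)(N - 2k).\<close>

lemma one_plus_power_mult_one_minus_eq_sum:
  fixes c :: "'a::real_algebra_1"
  shows "real (Suc n) *\<^sub>R ((1 + c) ^ n * (1 - c))
    = (\<Sum>k\<le>Suc n. real (Suc n choose k) *\<^sub>R ((real (Suc n) - 2 * real k) *\<^sub>R c ^ k))"
proof (induction n)
  case (Suc n)
  have comm: "c ^ k * (1 + c) = (1 + c) * c ^ k" for k
    by (simp add: algebra_simps power_commutes)
  have "(\<Sum>k\<le>Suc (Suc n). real (Suc (Suc n) choose k) *\<^sub>R ((real (Suc (Suc n)) - 2 * real k) *\<^sub>R c ^ k))
      = (\<Sum>k\<le>Suc n. real (Suc n choose k) *\<^sub>R
          ((real (Suc (Suc n)) - 2 * real k) *\<^sub>R c ^ k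
            + (real (Suc (Suc n)) - 2 * real (Suc k)) *\<^sub>R c ^ Suc k))"
    by (rule sum_binomial_Suc)
  also have "\<dots> = (\<Sum>k\<le>Suc n. (1 + c) * (real (Suc n choose k) *\<^sub>R ((real (Suc n) - 2 * real k) *\<^sub>R c ^ k))
      + (real (Suc n choose k) *\<^sub>R c ^ k) * (1 - c))"
  proof (intro sum.cong refl)
    fix k
    \<comment> \<open>With \<open>d\<close> = n + 1 - 2k the two new coefficients are
      \<open>d + 1\<close> and \<open>d - 1\<close>. The multiples of \<open>d\<close> give
      \<open>1 + c\<close> times the old summand; the remainder \<open>y - c * y\<close> sums to the
      expansion of \<open>(1 + c) ^ Suc n * (1 - c)\<close>.\<close>
    have "r *\<^sub>R ((d + 1) *\<^sub>R y + (d - 1) *\<^sub>R (c * y))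
        = (1 + c) * (r *\<^sub>R (d *\<^sub>R y)) + (r *\<^sub>R y - r *\<^sub>R (c * y))" for r d and y :: 'a
      by (simp add: algebra_simps)
    from this[of "real (Suc n choose k)" "real (Suc n) - 2 * real k" "c ^ k"]
    have "real (Suc n choose k) *\<^sub>R
          ((real (Suc (Suc n)) - 2 * real k) *\<^sub>R c ^ k
            + (real (Suc (Suc n)) - 2 * real (Suc k)) *\<^sub>R c ^ Suc k)
        = (1 + c) * (real (Suc n choose k) *\<^sub>R ((real (Suc n) - 2 * real k) *\<^sub>R c ^ k))
          + (real (Suc n choose k) *\<^sub>R c ^ k - real (Suc n choose k) *\<^sub>R c ^ Suc k)"
      by (simp add: add_diff_eq diff_add_eq add.commute)
    then show "real (Suc n choose k) *\<^sub>R
          ((real (Suc (Suc n)) - 2 * real k) *\<^sub>R c ^ k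
            + (real (Suc (Suc n)) - 2 * real (Suc k)) *\<^sub>R c ^ Suc k)
        = (1 + c) * (real (Suc n choose k) *\<^sub>R ((real (Suc n) - 2 * real k) *\<^sub>R c ^ k))
            + (real (Suc n choose k) *\<^sub>R c ^ k) * (1 - c)"
      by (simp only: right_diff_distrib mult_1_right mult_scaleR_left power_Suc2)
  qed
  also have "\<dots> = (1 + c) * (real (Suc n) *\<^sub>R ((1 + c) ^ n * (1 - c))) + (1 + c) ^ Suc n * (1 - c)"
    by (simp only: sum.distrib Suc one_plus_power_eq_sum[of c "Suc n"] flip: sum_distrib_left sum_distrib_right)
  also have "\<dots> = real (Suc (Suc n)) *\<^sub>R ((1 + c) ^ Suc n * (1 - c))"
    by (simp only: of_nat_Suc[of "Suc n"] power_Suc mult.assoc mult_scaleR_right scaleR_left_distrib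
        scaleR_one add.commute)
  finally show ?case ..
qed (simp add: algebra_simps scaleR_2)

text \<open>The absolute values of the coefficients add up to the first absolute moment. What
  matters is the gain of a factor sqrt(n+1) over the trivial bound \<open>2 ^ Suc n\<close>.\<close>

lemma norm_one_plus_power_mult_one_minus_le:
  fixes c :: "'a::real_normed_algebra_1"
  assumes "norm c \<le> 1"
  shows "norm ((1 + c) ^ n * (1 - c)) \<le> 2 ^ Suc n / sqrt (real (Suc n))"
proof -
  have "real (Suc n) * norm ((1 + c) ^ n * (1 - c)) = norm (real (Suc n) *\<^sub>R ((1 + c) ^ n * (1 - c)))"
    by simp
  also have "\<dots> \<le> (\<Sum>k\<le>Suc n. norm (real (Suc n choose k) *\<^sub>R ((real (Suc n) - 2 * real k) *\<^sub>R c ^ k)))"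
    unfolding one_plus_power_mult_one_minus_eq_sum by (rule norm_sum)
  also have "\<dots> \<le> (\<Sum>k\<le>Suc n. real (Suc n choose k) * \<bar>real (Suc n) - 2 * real k\<bar>)"
  proof (intro sum_mono)
    fix k
    have "norm (c ^ k) \<le> 1"
      by (metis assms norm_ge_zero norm_power_ineq order_trans power_le_one)
    then have "real (Suc n choose k) * (\<bar>real (Suc n) - 2 * real k\<bar> * norm (c ^ k))
        \<le> real (Suc n choose k) * (\<bar>real (Suc n) - 2 * real k\<bar> * 1)"
      by (intro mult_left_mono) auto
    then show "norm (real (Suc n choose k) *\<^sub>R ((real (Suc n) - 2 * real k) *\<^sub>R c ^ k))
        \<le> real (Suc n choose k) * \<bar>real (Suc n) - 2 * real k\<bar>"
      by (simp only: norm_scaleR abs_of_nat mult_1_right)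
  qed
  also have "\<dots> \<le> sqrt (real (Suc n)) * 2 ^ Suc n"
    by (rule binomial_first_absolute_moment)
  also have "\<dots> = real (Suc n) * (2 ^ Suc n / sqrt (real (Suc n)))"
    by (metis of_nat_0_le_iff real_div_sqrt times_divide_eq_right mult.commute times_divide_eq_left)
  finally show ?thesis
    by (rule mult_left_le_imp_le) simp
qed

section \<open>Norm and order in a C*-algebra\<close>

lemma star_one [simp]: "star (1::'a::cstar_algebra) = 1"
  by (metis mult.left_neutral mult_1_right star_mult star_star)

lemma star_scaleR: "star (r *\<^sub>R x) = r *\<^sub>R star (x::'a::cstar_algebra)"
  by (metis complex_cnj_complex_of_real scaleC_of_real star_scaleC)

lemma star_minus: "star (- x) = - star (x::'a::cstar_algebra)"
  using star_scaleR[of "-1" x] by simp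

lemma star_diff: "star (x - y) = star x - star (y::'a::cstar_algebra)"
  using star_add[of x "- y"] by (simp add: star_minus)

lemma star_power: "star (x ^ n) = star (x::'a::cstar_algebra) ^ n"
  by (induction n) (simp_all add: star_mult power_commutes)

lemma norm_star [simp]: "norm (star x) = norm (x::'a::cstar_algebra)"
proof -
  have le: "norm y \<le> norm (star y)" for y :: 'a
  proof (cases "y = 0")
    case False
    have "norm y * norm y \<le> norm (star y) * norm y"
      by (metis cstar_identity norm_mult_ineq power2_eq_square)
    then show ?thesis
      using False by simp
  qed simp
  show ?thesis
    using le[of x] le[of "star x"] by (simp add: star_star)
qed

lemma scaleC_i_i: "\<i> *\<^sub>C \<i> *\<^sub>C x = - (x::'a::cstar_algebra)"
  using scaleC_of_real[of "-1" x] by (simp add: scaleC_scaleC)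

lemma star_scaleC_i: "star (\<i> *\<^sub>C x) = - (\<i> *\<^sub>C star (x::'a::cstar_algebra))"
proof -
  have "star (\<i> *\<^sub>C x) = (complex_of_real (-1) * \<i>) *\<^sub>C star x"
    by (simp add: star_scaleC)
  also have "\<dots> = - (\<i> *\<^sub>C star x)"
    by (simp only: scaleC_scaleC[symmetric] scaleC_of_real) simp
  finally show ?thesis .
qed

text \<open>Both parts are half the sum or half the difference of the element and its star, which
  have equal norms.\<close>

lemma norm_self_adjoint_le_norm_add_i:
  fixes a b :: "'a::cstar_algebra"
  assumes "star a = a" "star b = b"
  shows "norm a \<le> norm (a + \<i> *\<^sub>C b)" "norm b \<le> norm (a + \<i> *\<^sub>C b)"
proof -
  let ?x = "a + \<i> *\<^sub>C b"
  have st: "star ?x = a - \<i> *\<^sub>C b"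
    using assms by (simp add: star_add star_scaleC_i)
  have "2 *\<^sub>R a = ?x + star ?x"
    unfolding st by (simp add: scaleR_2)
  then have "2 * norm a \<le> 2 * norm ?x"
    by (metis abs_numeral mult_2 norm_scaleR norm_star norm_triangle_ineq)
  then show "norm a \<le> norm ?x" by simp
  have "2 *\<^sub>R (\<i> *\<^sub>C b) = ?x - star ?x"
    unfolding st by (simp add: scaleR_2)
  then have "norm (2 *\<^sub>R (\<i> *\<^sub>C b)) \<le> 2 * norm ?x"
    by (metis mult_2 norm_star norm_triangle_ineq4)
  then show "norm b \<le> norm ?x"
    by (simp add: norm_scaleC)
qed

text \<open>For self-adjoint elements the C*-identity says that squaring the element squares the
  norm; iterate.\<close>

lemma norm_self_adjoint_power2_power:
  fixes a :: "'a::cstar_algebra"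
  assumes "star a = a"
  shows "norm (a ^ 2 ^ n) = norm a ^ 2 ^ n"
proof (induction n)
  case (Suc n)
  have "norm (a ^ 2 ^ Suc n) = norm (star (a ^ 2 ^ n) * a ^ 2 ^ n)"
    by (simp add: star_power assms power_mult mult.commute flip: power_add mult_2)
  also have "\<dots> = norm a ^ 2 ^ Suc n"
    by (simp add: cstar_identity Suc power_mult mult.commute flip: power_mult)
  finally show ?case .
qed simp

text \<open>
  With \<open>x = 1 + \<i>a\<close> one has \<open>star x * x = 1 + a\<^sup>2\<close>, while \<open>2a\<close> is the imaginary part of \<open>x\<^sup>2\<close>.
\<close>

lemma norm_one_plus_square_ge:
  fixes a :: "'a::cstar_algebra"
  assumes "star a = a"
  shows "2 * norm a \<le> norm (1 + a * a)"
proof -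
  let ?x = "1 + \<i> *\<^sub>C a"
  have st: "star ?x = 1 - \<i> *\<^sub>C a"
    using assms by (simp add: star_add star_scaleC_i)
  have i2: "\<i> *\<^sub>C a * \<i> *\<^sub>C a = - (a * a)"
    by (simp add: mult_scaleC_left mult_scaleC_right scaleC_i_i)
  have "star ?x * ?x = 1 + a * a"
    unfolding st using i2 by (simp add: algebra_simps)
  moreover have "?x * ?x = (1 - a * a) + \<i> *\<^sub>C (a + a)"
    using i2 by (simp add: algebra_simps scaleC_add_right)
  moreover have "norm (a + a) \<le> norm ((1 - a * a) + \<i> *\<^sub>C (a + a))"
    using assms by (intro norm_self_adjoint_le_norm_add_i) (simp_all add: star_add star_diff star_mult)
  moreover have "norm (?x * ?x) \<le> norm (star ?x * ?x)"
    by (metis cstar_identity norm_mult_ineq power2_eq_square)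
  moreover have "norm (a + a) = 2 * norm a"
    by (simp flip: scaleR_2)
  ultimately show ?thesis by simp
qed

text \<open>
  \<open>T = (1 + a\<^sup>2) / 2\<close> satisfies \<open>\<parallel>T ^ 2 ^ k\<parallel> \<ge> 1\<close> by the C*-identity, while \<open>T ^ n * (1 - T)\<close>
  tends to \<open>0\<close>.
\<close>

lemma one_minus_square_not_right_invertible:
  fixes a g :: "'a::cstar_algebra"
  assumes sa: "star a = a" and norm: "norm a = 1"
  shows "(1 - a * a) * g \<noteq> 1"
proof
  assume g: "(1 - a * a) * g = 1"
  have c: "norm (a * a) \<le> 1"
    using norm_mult_ineq[of a a] norm by simp
  \<comment> \<open>Since \<open>g\<close> cancels the factor \<open>1 - a * a\<close>, the decay of
    \<open>(1 + a * a) ^ N * (1 - a * a)\<close> relative to \<open>2 ^ N\<close> would pass to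
    \<open>(1 + a * a) ^ N\<close>, whose norm is at least \<open>2 ^ N\<close> when N is a power of
    two.\<close>
  have bound: "sqrt (real (Suc (2 ^ n))) \<le> 2 * norm g" for n
  proof -
    let ?N = "2 ^ n :: nat"
    define s where "s = sqrt (real (Suc ?N))"
    have s: "s > 0"
      unfolding s_def by (simp only: real_sqrt_gt_0_iff of_nat_0_less_iff)
    have "2 ^ ?N \<le> norm (1 + a * a) ^ ?N"
      using norm_one_plus_square_ge[OF sa] norm by (intro power_mono) auto
    also have "\<dots> = norm ((1 + a * a) ^ ?N)"
      using sa by (intro norm_self_adjoint_power2_power[symmetric]) (simp add: star_add star_mult)
    also have "\<dots> = norm ((1 + a * a) ^ ?N * (1 - a * a) * g)"
      by (simp add: mult.assoc g)
    also have "\<dots> \<le> norm ((1 + a * a) ^ ?N * (1 - a * a)) * norm g"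
      by (rule norm_mult_ineq)
    also have "\<dots> \<le> 2 ^ Suc ?N / s * norm g"
      unfolding s_def by (intro mult_right_mono norm_one_plus_power_mult_one_minus_le c) simp
    finally have "2 ^ ?N * s \<le> 2 ^ ?N * (2 * norm g)"
      using s by (simp add: field_simps)
    then show ?thesis
      unfolding s_def[symmetric] by (rule mult_left_le_imp_le) simp
  qed
  obtain n where "(2 * norm g)\<^sup>2 < real n"
    using reals_Archimedean2 by blast
  also have "real n \<le> real (Suc (2 ^ n))"
    by (simp only: of_nat_le_iff) (rule order_trans[OF less_imp_le[OF less_exp]], simp)
  also have "\<dots> \<le> (2 * norm g)\<^sup>2"
    using bound[of n] by (metis of_nat_0_le_iff real_sqrt_ge_zero power_mono real_sqrt_pow2)
  finally show False by simp
qed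

section \<open>Real points of the spectrum\<close>

lemma scaleC_of_real_one: "complex_of_real r *\<^sub>C (1::'a::cstar_algebra) = of_real r"
  by (simp only: scaleC_of_real) (simp add: of_real_def)

lemma spectrum_of_real_iff:
  "complex_of_real r \<in> cstar_spectrum a
    \<longleftrightarrow> \<not> (\<exists>b. b * (of_real r - a) = 1 \<and> (of_real r - a) * b = 1)"
  by (simp add: cstar_spectrum_def scaleC_of_real_one)

text \<open>This stands in for the spectral radius formula. If both points were outside the
  spectrum, then for \<open>x = a / norm a\<close> the product of \<open>1 - x\<close> and
  \<open>1 + x\<close>, which is \<open>1 - x * x\<close>, would have a right inverse.\<close>

lemma norm_mem_spectrum_or_uminus:
  fixes a :: "'a::cstar_algebra"
  assumes sa: "star a = a"
  shows "complex_of_real (norm a) \<in> cstar_spectrum a \<or> complex_of_real (- norm a) \<in> cstar_spectrum a"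
proof (rule ccontr)
  assume contr: "\<not> ?thesis"
  define r where "r = norm a"
  obtain b c where b: "(of_real r - a) * b = 1" and c: "(of_real (- r) - a) * c = 1"
    using contr unfolding spectrum_of_real_iff r_def by blast
  have "r \<noteq> 0"
    using b by (auto simp: r_def)
  then have r: "r > 0"
    by (simp add: r_def)
  define x where "x = (1 / r) *\<^sub>R a"
  have a: "a = r *\<^sub>R x"
    using r by (simp add: x_def)
  have prod: "(r *\<^sub>R (1 - x)) * (r *\<^sub>R (1 + x)) = r\<^sup>2 *\<^sub>R (1 - x * x)"
    by (simp add: algebra_simps power2_eq_square)
  have "(r *\<^sub>R (1 + x)) * (- c) = 1"
    using c by (simp add: a of_real_def scaleR_right_distrib algebra_simps)
  then have "(r *\<^sub>R (1 - x)) * (r *\<^sub>R (1 + x)) * (- c * b) = (r *\<^sub>R (1 - x)) * b"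
    by (metis mult.assoc mult.left_neutral)
  also have "\<dots> = 1"
    using b by (simp add: a of_real_def scaleR_right_diff_distrib)
  finally have "(1 - x * x) * (r\<^sup>2 *\<^sub>R (- c * b)) = 1"
    unfolding prod by simp
  moreover have "star x = x" "norm x = 1"
    using r sa by (simp_all add: x_def star_scaleR) (simp add: r_def)
  ultimately show False
    using one_minus_square_not_right_invertible by blast
qed

text \<open>The sum of the Neumann series, obtained as the fixed point of the contraction sending
  \<open>b\<close> to \<open>1 + a * b\<close>.\<close>

lemma right_inverse_one_minus:
  fixes a :: "'a::{real_normed_algebra_1, banach}"
  assumes "norm a < 1"
  obtains b where "(1 - a) * b = 1"
proof -
  have "\<exists>!b. 1 + a * b = b"
  proof (rule banach_fix_type[of "norm a"])
    show "\<forall>x y. dist (1 + a * x) (1 + a * y) \<le> norm a * dist x y"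
      by (metis add_diff_cancel_left dist_norm norm_mult_ineq right_diff_distrib)
  qed (use assms in auto)
  then obtain b where "1 + a * b = b" by auto
  then show ?thesis
    by (intro that[of b]) (simp add: algebra_simps)
qed

lemma left_inverse_one_minus:
  fixes a :: "'a::{real_normed_algebra_1, banach}"
  assumes "norm a < 1"
  obtains b where "b * (1 - a) = 1"
proof -
  have "\<exists>!b. 1 + b * a = b"
  proof (rule banach_fix_type[of "norm a"])
    show "\<forall>x y. dist (1 + x * a) (1 + y * a) \<le> norm a * dist x y"
      by (metis add_diff_cancel_left dist_norm left_diff_distrib mult.commute norm_mult_ineq)
  qed (use assms in auto)
  then obtain b where "1 + b * a = b" by auto
  then show ?thesis
    by (intro that[of b]) (simp add: algebra_simps)
qed

lemma spectrum_of_real_le_norm: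
  fixes a :: "'a::cstar_algebra"
  assumes "complex_of_real r \<in> cstar_spectrum a"
  shows "r \<le> norm a"
proof (rule ccontr)
  assume "\<not> ?thesis"
  then have r: "norm a < r" by simp
  then have r0: "r > 0"
    using norm_ge_zero[of a] by linarith
  define x where "x = (1 / r) *\<^sub>R a"
  have x: "norm x < 1" "of_real r - a = r *\<^sub>R (1 - x)"
    using r r0 by (simp_all add: x_def of_real_def scaleR_right_diff_distrib)
  obtain b where b: "(1 - x) * b = 1"
    using right_inverse_one_minus x(1) by blast
  obtain b' where b': "b' * (1 - x) = 1"
    using left_inverse_one_minus x(1) by blast
  have "b' = b"
    by (metis b b' mult.assoc mult.left_neutral mult.right_neutral)
  then have "((1 / r) *\<^sub>R b) * (of_real r - a) = 1 \<and> (of_real r - a) * ((1 / r) *\<^sub>R b) = 1"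
    using b b' r0 by (simp add: x(2))
  then show False
    using assms unfolding spectrum_of_real_iff by blast
qed

lemma spectrum_of_real_shift:
  "complex_of_real (s + r) \<in> cstar_spectrum (of_real s + a) \<longleftrightarrow> complex_of_real r \<in> cstar_spectrum a"
  unfolding spectrum_of_real_iff by simp

lemma spectrum_of_real_reflect:
  "complex_of_real (s - r) \<in> cstar_spectrum (of_real s - a) \<longleftrightarrow> complex_of_real r \<in> cstar_spectrum a"
proof -
  have "of_real (s - r) - (of_real s - a) = - (of_real r - a)" by simp
  then show ?thesis
    unfolding spectrum_of_real_iff by (metis minus_mult_minus minus_mult_commute minus_minus)
qed

section \<open>Positive elements and monotonicity of the norm\<close>

lemma cstar_positive_spectrum_of_real_nonneg:
  "cstar_positive a \<Longrightarrow> complex_of_real r \<in> cstar_spectrum a \<Longrightarrow> 0 \<le> r"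
  unfolding cstar_positive_def by (auto simp: nonneg_Reals_of_real_iff)

lemma star_of_real: "star (of_real r :: 'a::cstar_algebra) = of_real r"
  by (simp add: of_real_def star_scaleR)

text \<open>Let n be the norm of t - p. Then n or -n lies in the spectrum of t - p, so by reflection
  t - n or t + n lies in that of p. The first is nonnegative by positivity; the second is at most
  \<open>norm p\<close>, hence at most t.\<close>

lemma cstar_positive_norm_diff_le:
  assumes p: "cstar_positive p" and t: "norm p \<le> t"
  shows "norm (of_real t - p) \<le> t"
proof -
  let ?n = "norm (of_real t - p)"
  have "star (of_real t - p) = of_real t - p"
    using p by (simp add: cstar_positive_def star_diff star_of_real)
  then consider "complex_of_real ?n \<in> cstar_spectrum (of_real t - p)"
    | "complex_of_real (- ?n) \<in> cstar_spectrum (of_real t - p)"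
    using norm_mem_spectrum_or_uminus by blast
  then show ?thesis
  proof cases
    case 1
    moreover have "?n = t - (t - ?n)"
      by simp
    ultimately have "complex_of_real (t - ?n) \<in> cstar_spectrum p"
      by (metis spectrum_of_real_reflect)
    then have "0 \<le> t - ?n"
      by (rule cstar_positive_spectrum_of_real_nonneg[OF p])
    then show ?thesis by simp
  next
    case 2
    then have "complex_of_real (t + ?n) \<in> cstar_spectrum p"
      using spectrum_of_real_reflect[of t "t + ?n" p] by simp
    then have "t + ?n \<le> norm p"
      by (rule spectrum_of_real_le_norm)
    then show ?thesis
      using t norm_ge_zero[of p] by linarith
  qed
qed

lemma cstar_positive_norm_mem_spectrum:
  assumes "cstar_positive p"
  shows "complex_of_real (norm p) \<in> cstar_spectrum p"
  using norm_mem_spectrum_or_uminus[of p] cstar_positive_spectrum_of_real_nonneg[OF assms, of "- norm p"]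
    assms by (auto simp: cstar_positive_def)

text \<open>Shift by \<open>t = norm (b - a)\<close>: the spectrum of \<open>t + a\<close> contains
  \<open>t + norm a\<close>, while \<open>t + a = (t - (b - a)) + b\<close> has norm at most
  \<open>t + norm b\<close>.\<close>

lemma cstar_le_norm_mono:
  assumes a: "cstar_positive a" and "a \<preceq> b"
  shows "norm a \<le> norm b"
proof -
  have q: "cstar_positive (b - a)"
    using assms(2) by (simp add: cstar_le_def)
  let ?t = "norm (b - a)"
  have "complex_of_real (?t + norm a) \<in> cstar_spectrum (of_real ?t + a)"
    using cstar_positive_norm_mem_spectrum[OF a] by (simp only: spectrum_of_real_shift)
  then have "?t + norm a \<le> norm (of_real ?t + a)"
    by (rule spectrum_of_real_le_norm)
  also have "\<dots> = norm ((of_real ?t - (b - a)) + b)"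
    by simp
  also have "\<dots> \<le> ?t + norm b"
    using cstar_positive_norm_diff_le[OF q order_refl] norm_triangle_ineq by (smt (verit))
  finally show ?thesis by simp
qed

section \<open>Hilbert modules\<close>

text \<open>With a right inverse \<open>G\<close> of \<open>T\<close>, a solution is
  \<open>x = G z\<close> where \<open>z\<close> is the fixed point of \<open>z\<close> mapped to
  \<open>y - R (G z)\<close>. The lower bound on \<open>T\<close>, applied to
  \<open>G v - G u\<close>, makes this map a contraction with factor \<open>r / c\<close>.\<close>

lemma surj_perturbation:
  fixes T R :: "'h::banach \<Rightarrow> 'h"
  assumes T: "\<And>x y. T (x - y) = T x - T y" and R: "\<And>x y. R (x - y) = R x - R y"
    and below: "\<And>x. c * norm x \<le> norm (T x)" and surj: "surj T"
    and bound: "\<And>x. norm (R x) \<le> r * norm x" and r: "0 \<le> r" "r < c"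
  shows "surj (\<lambda>x. T x + R x)"
  unfolding surj_def
proof
  fix y
  define G where "G = inv T"
  have TG: "T (G z) = z" for z
    using surj by (simp add: G_def surj_f_inv_f)
  have c: "c > 0"
    using r by linarith
  have "\<exists>!z. y - R (G z) = z"
  proof (rule banach_fix_type[of "r / c"])
    show "\<forall>u v. dist (y - R (G u)) (y - R (G v)) \<le> r / c * dist u v"
    proof (intro allI)
      fix u v
      have "dist (y - R (G u)) (y - R (G v)) = norm (R (G v - G u))"
        by (simp add: dist_norm R)
      also have "\<dots> \<le> r * norm (G v - G u)"
        by (rule bound)
      also have "\<dots> \<le> r * (norm (v - u) / c)"
        using below[of "G v - G u"] c r(1)
        by (intro mult_left_mono) (simp_all add: T TG field_simps)
      also have "\<dots> = r / c * dist u v"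
        by (simp add: dist_norm norm_minus_commute)
      finally show "dist (y - R (G u)) (y - R (G v)) \<le> r / c * dist u v" .
    qed
  qed (use r c in auto)
  then obtain z where z: "y - R (G z) = z" by auto
  then have "y = T (G z) + R (G z)"
    by (metis TG add.commute diff_add_cancel)
  then show "\<exists>x. y = T x + R x" ..
qed

lemma banach_exhaustion_ball:
  fixes F :: "nat \<Rightarrow> 'h::banach set"
  assumes "\<And>n. closed (F n)" and "(\<Union>n. F n) = UNIV"
  obtains n x e where "e > 0" "ball x e \<subseteq> F n"
proof -
  have "\<exists>n. interior (F n) \<noteq> {}"
  proof (rule ccontr)
    assume "\<not> ?thesis"
    then have "euclidean interior_of (\<Union> (range F)) = {}"
      using assms(1)
      by (intro Baire_category_alt disjI1 completely_metrizable_space_euclidean) auto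
    then show False
      using assms(2) by simp
  qed
  then show thesis
    using that by (metis ex_in_conv mem_interior)
qed

section \<open>Inner product calculus and uniform boundedness\<close>

context hilbert_module
begin

lemma ip_add_right: "ip x (y + z) = ip x y + ip x z"
  by (metis ip_add_left ip_star star_add)

lemma ip_sm_right: "ip x (sm a y) = ip x y * star a"
  by (metis ip_sm_left ip_star star_mult)

lemma ip_scaleR_left: "ip (r *\<^sub>R x) y = r *\<^sub>R ip x y"
  by (metis ip_sm_left mult_scaleR_left mult.left_neutral sm_scaleR)

lemma ip_scaleR_right: "ip x (r *\<^sub>R y) = r *\<^sub>R ip x y"
  by (metis ip_scaleR_left ip_star star_scaleR)

lemma ip_minus_left: "ip (- x) y = - ip x y"
  using ip_scaleR_left[of "-1"] by simp

lemma ip_minus_right: "ip x (- y) = - ip x y"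
  using ip_scaleR_right[of _ "-1"] by simp

lemma ip_diff_left: "ip (x - y) z = ip x z - ip y z"
  using ip_add_left[of x "- y"] by (simp add: ip_minus_left)

lemma ip_diff_right: "ip x (y - z) = ip x y - ip x z"
  using ip_add_right[of x y "- z"] by (simp add: ip_minus_right)

lemma norm_ip_self: "norm (ip x x) = (norm x)\<^sup>2"
  by (simp add: norm_eq_sqrt_ip)

lemma ip_left_ext: "(\<And>z. ip x z = ip y z) \<Longrightarrow> x = y"
  by (metis eq_iff_diff_eq_0 ip_definite ip_diff_left)

lemma ip_right_ext: "(\<And>z. ip z x = ip z y) \<Longrightarrow> x = y"
  by (metis ip_left_ext ip_star)

text \<open>The type \<open>'h\<close> has only real scalars, so the complex structure used in
  polarization and in the imaginary shifts of operators is taken from the algebra.\<close>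

definition im :: "'h \<Rightarrow> 'h" where
  "im x = sm (\<i> *\<^sub>C 1) x"

lemma ip_im_left: "ip (im x) y = \<i> *\<^sub>C ip x y"
  by (simp add: im_def ip_sm_left mult_scaleC_left)

lemma ip_im_right: "ip x (im y) = - (\<i> *\<^sub>C ip x y)"
  by (simp add: im_def ip_sm_right star_scaleC_i mult_scaleC_right)

lemma im_diff: "im (x - y) = im x - im y"
  using sm_add_right[of "\<i> *\<^sub>C 1" "x - y" y] by (simp add: im_def)

lemma norm_im [simp]: "norm (im x) = norm x"
proof -
  have "ip (im x) (im x) = ip x x"
    by (simp add: ip_im_left ip_im_right star_scaleC_i scaleC_i_i)
  then show ?thesis
    by (simp add: norm_eq_sqrt_ip)
qed

lemma im_im: "im (im x) = - x"
  by (rule ip_left_ext) (simp add: ip_im_left scaleC_i_i ip_minus_left)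

text \<open>
  Polarization replaces the Cauchy-Schwarz inequality, at the price of the constant \<open>4\<close>.
\<close>

lemma norm_ip_le: "norm (ip x y) \<le> 4 * norm x * norm y"
proof -
  have unit: "norm (ip u v) \<le> 4" if "norm u = 1" "norm v = 1" for u v
  proof -
    have sq: "norm (ip (u + w) (u + w)) \<le> 4" "norm (ip (u - w) (u - w)) \<le> 4" if "norm w = 1" for w
    proof -
      have "norm (u + w) \<le> 2" "norm (u - w) \<le> 2"
        using norm_triangle_ineq[of u w] norm_triangle_ineq4[of u w] \<open>norm u = 1\<close> that by auto
      then have "(norm (u + w))\<^sup>2 \<le> 2\<^sup>2" "(norm (u - w))\<^sup>2 \<le> 2\<^sup>2"
        by (simp_all only: power_mono norm_ge_zero)
      then show "norm (ip (u + w) (u + w)) \<le> 4" "norm (ip (u - w) (u - w)) \<le> 4"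
        by (simp_all add: norm_ip_self)
    qed
    have A: "ip (u + w) (u + w) - ip (u - w) (u - w) = 2 *\<^sub>R (ip u w + ip w u)" for w
      by (simp add: ip_add_left ip_add_right ip_diff_left ip_diff_right scaleR_2)
    have B: "2 *\<^sub>R (ip u (im v) + ip (im v) u) = \<i> *\<^sub>C (2 *\<^sub>R (ip v u - ip u v))"
      by (simp add: ip_im_left ip_im_right scaleR_2)
        (metis (no_types, lifting) add.commute add_diff_cancel_left' diff_add_cancel diff_add_eq
          scaleC_add_right uminus_add_conv_diff)
    have n1: "norm (2 *\<^sub>R (ip u v + ip v u)) \<le> 8"
      using norm_triangle_ineq4[of "ip (u + v) (u + v)" "ip (u - v) (u - v)"] sq[of v] that
      unfolding A by simp
    have "norm (2 *\<^sub>R (ip u (im v) + ip (im v) u)) \<le> 8"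
      using norm_triangle_ineq4[of "ip (u + im v) (u + im v)" "ip (u - im v) (u - im v)"]
        sq[of "im v"] that
      unfolding A by simp
    then have n2: "norm (2 *\<^sub>R (ip v u - ip u v)) \<le> 8"
      unfolding B norm_scaleC by simp
    have "4 *\<^sub>R ip u v = 2 *\<^sub>R (ip u v + ip v u) - 2 *\<^sub>R (ip v u - ip u v)"
      by (simp add: algebra_simps flip: scaleR_left_distrib)
    then have "norm (4 *\<^sub>R ip u v) \<le> 8 + 8"
      using n1 n2 norm_triangle_ineq4 by (smt (verit))
    then show ?thesis by simp
  qed
  show ?thesis
  proof (cases "x = 0 \<or> y = 0")
    case True
    then have "ip x y = 0"
      using ip_scaleR_left[of 0 x y] ip_scaleR_right[of x 0 y] by auto
    then show ?thesis by simp
  next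
    case False
    define u v where "u = (1 / norm x) *\<^sub>R x" and "v = (1 / norm y) *\<^sub>R y"
    have "norm (ip u v) \<le> 4"
      using False by (intro unit) (auto simp: u_def v_def)
    then have "norm x * norm y * norm (ip u v) \<le> norm x * norm y * 4"
      by (intro mult_left_mono) auto
    moreover have "x = norm x *\<^sub>R u" "y = norm y *\<^sub>R v"
      using False by (auto simp: u_def v_def)
    then have "ip x y = (norm x * norm y) *\<^sub>R ip u v"
      by (metis ip_scaleR_left ip_scaleR_right scaleR_scaleR)
    then have "norm (ip x y) = norm x * norm y * norm (ip u v)"
      by simp
    ultimately show ?thesis by simp
  qed
qed

lemma bounded_bilinear_ip: "bounded_bilinear ip"
proof
  show "\<exists>K. \<forall>x y. norm (ip x y) \<le> norm x * norm y * K"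
    using norm_ip_le by (intro exI[of _ 4]) (simp add: mult_ac)
qed (simp_all add: ip_add_left ip_add_right ip_scaleR_left ip_scaleR_right)

text \<open>Banach-Steinhaus for the continuous maps sending \<open>z\<close> to
  \<open>ip z y\<close>: by Baire, one bound \<open>n\<close> holds for all \<open>y\<close> in
  \<open>Y\<close> on a common ball.\<close>

lemma uniform_boundedness:
  assumes "\<And>z. \<exists>B. \<forall>y\<in>Y. norm (ip z y) \<le> B"
  shows "\<exists>B. \<forall>y\<in>Y. norm y \<le> B"
proof -
  define F where "F n = (\<Inter>y\<in>Y. {z. norm (ip z y) \<le> real n})" for n
  have "closed (F n)" for n
    unfolding F_def
    by (intro closed_INT ballI closed_Collect_le continuous_intros
        bounded_bilinear.continuous_on[OF bounded_bilinear_ip])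
  moreover have "(\<Union>n. F n) = UNIV"
  proof -
    have "\<exists>n. z \<in> F n" for z
    proof -
      obtain B where "\<forall>y\<in>Y. norm (ip z y) \<le> B"
        using assms by blast
      moreover obtain n where "B \<le> real n"
        using real_arch_simple by blast
      ultimately show ?thesis
        unfolding F_def by (auto intro: order_trans)
    qed
    then show ?thesis by auto
  qed
  ultimately obtain n x e where e: "e > 0" "ball x e \<subseteq> F n"
    by (rule banach_exhaustion_ball)
  have "norm y \<le> 4 * real n / e" if y: "y \<in> Y" for y
  proof (cases "y = 0")
    case False
    \<comment> \<open>A vector of length \<open>e / 2\<close> along \<open>y\<close>, so that
      \<open>ip w y\<close> has norm \<open>e * norm y / 2\<close>; as a difference of two values on
      the ball it has norm at most \<open>2 * n\<close>.\<close>
    define w where "w = (e / (2 * norm y)) *\<^sub>R y"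
    have "x + w \<in> ball x e" "x \<in> ball x e"
      using e False by (auto simp: w_def dist_norm)
    then have "norm (ip (x + w) y) \<le> real n" "norm (ip x y) \<le> real n"
      using e(2) y unfolding F_def by blast+
    moreover have "ip w y = ip (x + w) y - ip x y"
      by (simp add: ip_add_left)
    ultimately have "norm (ip w y) \<le> 2 * real n"
      using norm_triangle_ineq4[of "ip (x + w) y" "ip x y"] by simp
    moreover have "norm (ip w y) = e / (2 * norm y) * (norm y)\<^sup>2"
      using e by (simp add: w_def ip_scaleR_left norm_ip_self)
    ultimately show ?thesis
      using e False by (simp add: field_simps power2_eq_square)
  qed (use e in simp)
  then show ?thesis by blast
qed

section \<open>Adjoint pairs of operators\<close>

text \<open>A relation symmetric in the two operators; module linearity and boundedness of both
  follow from it alone.\<close>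

definition adjoint_pair :: "('h \<Rightarrow> 'h) \<Rightarrow> ('h \<Rightarrow> 'h) \<Rightarrow> bool" where
  "adjoint_pair T S \<longleftrightarrow> (\<forall>x y. ip (T x) y = ip x (S y))"

lemma adjoint_pairD: "adjoint_pair T S \<Longrightarrow> ip (T x) y = ip x (S y)"
  by (simp add: adjoint_pair_def)

lemma adjoint_pair_sym: "adjoint_pair T S \<Longrightarrow> adjoint_pair S T"
  unfolding adjoint_pair_def by (metis ip_star)

lemma adjoint_pair_comp:
  "adjoint_pair T S \<Longrightarrow> adjoint_pair T' S' \<Longrightarrow> adjoint_pair (T \<circ> T') (S' \<circ> S)"
  by (simp add: adjoint_pair_def)

lemma adjoint_pair_unique: "adjoint_pair T S \<Longrightarrow> adjoint_pair T S' \<Longrightarrow> S = S'"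
  unfolding adjoint_pair_def by (intro ext ip_right_ext) metis

lemma adjoint_pair_module_map:
  assumes "adjoint_pair T S"
  shows "T (x + y) = T x + T y" "T (x - y) = T x - T y" "T (r *\<^sub>R x) = r *\<^sub>R T x" "T (sm a x) = sm a (T x)"
  by (rule ip_left_ext; simp add: adjoint_pairD[OF assms] ip_add_left ip_diff_left ip_scaleR_left ip_sm_left)+

text \<open>Uniform boundedness applies to the image of the unit sphere, because
  \<open>ip z (T x) = ip (S z) x\<close> is bounded for each fixed \<open>z\<close>.\<close>

lemma adjoint_pair_bounded_linear:
  assumes T: "adjoint_pair T S"
  shows "bounded_linear T"
proof -
  have "\<exists>B. \<forall>y\<in>T ` {x. norm x = 1}. norm y \<le> B"
  proof (rule uniform_boundedness)
    fix z
    have "norm (ip z (T x)) \<le> 4 * norm (S z)" if "norm x = 1" for x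
      using norm_ip_le[of "S z" x] that by (simp add: adjoint_pairD[OF adjoint_pair_sym[OF T]])
    then show "\<exists>B. \<forall>y\<in>T ` {x. norm x = 1}. norm (ip z y) \<le> B"
      by blast
  qed
  then obtain B where B: "\<And>x. norm x = 1 \<Longrightarrow> norm (T x) \<le> B"
    by blast
  show ?thesis
  proof (rule bounded_linear_intro[where K = B])
    fix x
    show "norm (T x) \<le> norm x * B"
    proof (cases "x = 0")
      case True
      then show ?thesis
        using adjoint_pair_module_map(3)[OF T, of 0 x] by simp
    next
      case False
      have "norm (T ((1 / norm x) *\<^sub>R x)) \<le> B"
        using False by (intro B) simp
      then show ?thesis
        using False by (simp add: adjoint_pair_module_map(3)[OF T] field_simps)
    qed
  qed (use adjoint_pair_module_map[OF T] in auto)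
qed

text \<open>
  The positive square root of \<open>1 - A\<close> is \<open>1 - X\<close>, where \<open>X\<close> is the fixed point of the
  contraction \<open>X \<mapsto> (A + X\<^sup>2) / 2\<close>.
\<close>

lemma adjoint_pair_one_minus_eq_square:
  assumes A: "adjoint_pair A A" and bound: "\<And>x. norm (A x) \<le> 1 / 4 * norm x"
  obtains S where "adjoint_pair S S" "\<And>x. x - A x = S (S x)"
proof -
  define A' where "A' = Blinfun A"
  have A': "blinfun_apply A' = A"
    unfolding A'_def by (rule bounded_linear_Blinfun_apply[OF adjoint_pair_bounded_linear[OF A]])
  have nA: "norm A' \<le> 1 / 4"
    using bound by (intro norm_blinfun_bound) (auto simp: A')
  \<comment> \<open>On the ball of radius 1/2, \<open>f\<close> is a self-map with Lipschitz
    constant 1/2. Self-adjointness is a closed condition, so building it into \<open>D\<close>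
    passes it on to the fixed point.\<close>
  define D where "D = {X. norm X \<le> 1 / 2 \<and> adjoint_pair (blinfun_apply X) (blinfun_apply X)}"
  define f where "f X = (1 / 2) *\<^sub>R (A' + (X o\<^sub>L X))" for X :: "'h \<Rightarrow>\<^sub>L 'h"
  have "D = {X. norm X \<le> 1 / 2} \<inter> (\<Inter>x. \<Inter>y. {X. ip (blinfun_apply X x) y = ip x (blinfun_apply X y)})"
    by (auto simp: D_def adjoint_pair_def)
  moreover have "closed \<dots>"
    by (intro closed_Int closed_INT ballI closed_Collect_le closed_Collect_eq continuous_intros
        bounded_bilinear.continuous_on[OF bounded_bilinear_ip])
  ultimately have "complete D"
    by (simp add: complete_eq_closed)
  moreover have "0 \<in> D"
    using ip_scaleR_left[of 0] ip_scaleR_right[of _ 0] by (auto simp: D_def adjoint_pair_def)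
  moreover have "f ` D \<subseteq> D"
  proof (rule image_subsetI)
    fix X assume X: "X \<in> D"
    have "norm (X o\<^sub>L X) \<le> norm X * norm X"
      by (rule norm_blinfun_compose)
    also have "\<dots> \<le> 1 / 2 * (1 / 2)"
      using X by (intro mult_mono) (auto simp: D_def)
    finally have "norm (A' + (X o\<^sub>L X)) \<le> 1"
      using nA norm_triangle_ineq[of A' "X o\<^sub>L X"] by linarith
    then have "norm (f X) \<le> 1 / 2"
      by (simp add: f_def)
    moreover have "adjoint_pair (blinfun_apply (f X)) (blinfun_apply (f X))"
      using X A
      by (simp add: D_def f_def adjoint_pair_def A' ip_scaleR_left ip_scaleR_right
          ip_add_left ip_add_right plus_blinfun.rep_eq scaleR_blinfun.rep_eq)
    ultimately show "f X \<in> D"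
      by (simp add: D_def)
  qed
  moreover have "dist (f X) (f Y) \<le> 1 / 2 * dist X Y" if "X \<in> D" "Y \<in> D" for X Y
  proof -
    \<comment> \<open>\<open>X\<close> and \<open>Y\<close> need not commute, hence this form of the
      difference of squares.\<close>
    have "f X - f Y = (1 / 2) *\<^sub>R ((X o\<^sub>L (X - Y)) + ((X - Y) o\<^sub>L Y))"
      by (rule blinfun_eqI)
        (simp add: f_def plus_blinfun.rep_eq minus_blinfun.rep_eq scaleR_blinfun.rep_eq
          blinfun.diff_right algebra_simps)
    moreover have "norm (X o\<^sub>L (X - Y)) \<le> 1 / 2 * norm (X - Y)"
      using norm_blinfun_compose[of X "X - Y"] that mult_right_mono[of "norm X" "1 / 2" "norm (X - Y)"]
      by (auto simp: D_def)
    moreover have "norm ((X - Y) o\<^sub>L Y) \<le> norm (X - Y) * (1 / 2)"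
      using norm_blinfun_compose[of "X - Y" Y] that mult_left_mono[of "norm Y" "1 / 2" "norm (X - Y)"]
      by (auto simp: D_def)
    ultimately show ?thesis
      using norm_triangle_ineq[of "X o\<^sub>L (X - Y)" "(X - Y) o\<^sub>L Y"] by (simp add: dist_norm)
  qed
  ultimately have "\<exists>!X\<in>D. f X = X"
    by (intro Banach_fix[of D "1 / 2"]) auto
  then obtain X where X: "X \<in> D" "f X = X" by blast
  have fix_X: "A x + X (X x) = 2 *\<^sub>R X x" for x
  proof -
    have "2 *\<^sub>R f X = A' + (X o\<^sub>L X)"
      by (simp add: f_def)
    then have "blinfun_apply (2 *\<^sub>R X) x = blinfun_apply (A' + (X o\<^sub>L X)) x"
      using X(2) by simp
    then show ?thesis
      by (simp add: plus_blinfun.rep_eq scaleR_blinfun.rep_eq A')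
  qed
  show thesis
  proof (rule that[of "\<lambda>x. x - X x"])
    show "adjoint_pair (\<lambda>x. x - X x) (\<lambda>x. x - X x)"
      using X(1) by (simp add: D_def adjoint_pair_def ip_diff_left ip_diff_right)
    show "x - A x = (x - X x) - X (x - X x)" for x
      using fix_X[of x] by (simp add: blinfun.diff_right scaleR_2 algebra_simps)
  qed
qed

text \<open>For large \<open>C\<close> the operator \<open>A = T' T / C\<close> has norm at most
  1/4, so \<open>1 - A\<close> is the square of a self-adjoint operator, which times
  \<open>sqrt C\<close> is the new \<open>S\<close>. The parameter \<open>B\<close> allows
  \<open>C\<close> to be enlarged at will.\<close>

lemma adjoint_pair_ip_le:
  assumes T: "adjoint_pair T T'"
  obtains C S where "C > 0" "B \<le> C" "\<And>x. C *\<^sub>R ip x x - ip (T x) (T x) = ip (S x) (S x)"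
proof -
  obtain k l where k: "\<And>x. norm (T x) \<le> norm x * k" "k > 0" and l: "\<And>x. norm (T' x) \<le> norm x * l" "l > 0"
    using bounded_linear.pos_bounded adjoint_pair_bounded_linear T adjoint_pair_sym[OF T] by metis
  define C where "C = max (4 * k * l) B"
  have C: "C > 0" "B \<le> C" "k * l \<le> C / 4"
    using k l by (auto simp: C_def less_max_iff_disj)
  define A where "A x = (1 / C) *\<^sub>R T' (T x)" for x
  have A: "adjoint_pair A A"
    by (simp add: A_def adjoint_pair_def ip_scaleR_left ip_scaleR_right
        adjoint_pairD[OF adjoint_pair_sym[OF T]] flip: adjoint_pairD[OF T])
  have "norm (A x) \<le> 1 / 4 * norm x" for x
  proof -
    have "norm (T' (T x)) \<le> norm (T x) * l"
      by (rule l)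
    also have "\<dots> \<le> norm x * k * l"
      using k l by (intro mult_right_mono) auto
    also have "\<dots> \<le> norm x * (C / 4)"
      unfolding mult.assoc using C by (intro mult_left_mono) auto
    finally show ?thesis
      using C by (simp add: A_def field_simps)
  qed
  then obtain S where S: "adjoint_pair S S" "\<And>x. x - A x = S (S x)"
    using adjoint_pair_one_minus_eq_square[OF A] by metis
  have "C *\<^sub>R ip x x - ip (T x) (T x) = ip (sqrt C *\<^sub>R S x) (sqrt C *\<^sub>R S x)" for x
  proof -
    have "ip (S x) (S x) = ip x x - ip x (A x)"
      by (simp add: adjoint_pairD[OF S(1)] ip_diff_right flip: S(2))
    also have "\<dots> = ip x x - (1 / C) *\<^sub>R ip (T x) (T x)"
      by (simp add: A_def ip_scaleR_right adjoint_pairD[OF T])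
    finally show ?thesis
      using C by (simp add: ip_scaleR_left ip_scaleR_right scaleR_right_diff_distrib)
  qed
  then show thesis
    using that[of C "\<lambda>x. sqrt C *\<^sub>R S x"] C by simp
qed

section \<open>Surjectivity and lower bounds for the adjoint\<close>

text \<open>The set of \<open>y\<close> with \<open>norm (S y) \<le> 1\<close> is weakly bounded:
  every \<open>z\<close> is some \<open>T x\<close>, and \<open>ip z y = ip x (S y)\<close>. Uniform
  boundedness and scaling give the lower bound.\<close>

lemma surj_imp_adjoint_bounded_below:
  assumes T: "adjoint_pair T S" and "surj T"
  shows "bounded_below S"
proof -
  have "\<exists>B. \<forall>y\<in>{y. norm (S y) \<le> 1}. norm y \<le> B"
  proof (rule uniform_boundedness)
    fix z
    obtain x where x: "z = T x"
      using \<open>surj T\<close> by (metis surj_def)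
    have "norm (ip z y) \<le> 4 * norm x" if "norm (S y) \<le> 1" for y
    proof -
      have "norm (ip z y) \<le> 4 * norm x * norm (S y)"
        by (simp add: x adjoint_pairD[OF T] norm_ip_le)
      also have "\<dots> \<le> 4 * norm x * 1"
        using that by (intro mult_left_mono) auto
      finally show ?thesis by simp
    qed
    then show "\<exists>B. \<forall>y\<in>{y. norm (S y) \<le> 1}. norm (ip z y) \<le> B"
      by blast
  qed
  then obtain B where B: "\<And>y. norm (S y) \<le> 1 \<Longrightarrow> norm y \<le> B"
    by blast
  define C where "C = max B 1"
  have C: "C > 0" "\<And>y. norm (S y) \<le> 1 \<Longrightarrow> norm y \<le> C"
    using B by (auto simp: C_def max.coboundedI1)
  note scale = adjoint_pair_module_map(3)[OF adjoint_pair_sym[OF T]]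
  have "norm y \<le> C * norm (S y)" for y
  proof (cases "S y = 0")
    case True
    have "norm y = 0"
    proof (rule ccontr)
      assume y: "norm y \<noteq> 0"
      \<comment> \<open>A multiple of length \<open>C + 1\<close> is still annihilated by
        \<open>S\<close>, so it would have to obey the bound \<open>C\<close>.\<close>
      have "norm (((C + 1) / norm y) *\<^sub>R y) \<le> C"
        by (rule C(2)) (simp add: scale True)
      then show False
        using y C(1) by simp
    qed
    then show ?thesis
      using True by simp
  next
    case False
    have "norm ((1 / norm (S y)) *\<^sub>R y) \<le> C"
      using False by (intro C(2)) (simp add: scale)
    then show ?thesis
      using False by (simp add: field_simps)
  qed
  then have "\<forall>y. norm (S y) \<ge> 1 / C * norm y"
    using C(1) by (simp add: field_simps)
  then show ?thesis
    unfolding bounded_below_def using C(1) by (intro exI[of _ "1 / C"]) simp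
qed

text \<open>
  All operators \<open>T S + s\<i>\<close> with \<open>s\<close> real have the same lower bound, since the imaginary part
  cannot decrease the norm of \<open>\<langle>T S x, x\<rangle>\<close>.  For large \<open>s\<close> they are surjective, and a
  uniform lower bound lets surjectivity be carried down to \<open>s = 0\<close> in steps of fixed length.
\<close>

lemma adjoint_bounded_below_imp_surj_comp:
  assumes T: "adjoint_pair T S" and "bounded_below S"
  shows "surj (T \<circ> S)"
proof -
  obtain m where m: "m > 0" "\<And>x. m * norm x \<le> norm (S x)"
    using \<open>bounded_below S\<close> unfolding bounded_below_def by blast
  define P where "P x = T (S x)" for x
  note S = adjoint_pair_sym[OF T]
  have P_diff: "P (x - y) = P x - P y" for x y
    by (simp add: P_def adjoint_pair_module_map(2)[OF T] adjoint_pair_module_map(2)[OF S])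
  have "adjoint_pair P P"
    using adjoint_pair_comp[OF T S] by (simp add: P_def[abs_def] comp_def)
  then obtain k where k: "\<And>x. norm (P x) \<le> norm x * k" "k > 0"
    using bounded_linear.pos_bounded adjoint_pair_bounded_linear by metis
  \<comment> \<open>The 4 is the constant of \<open>norm_ip_le\<close>.\<close>
  define c where "c = m\<^sup>2 / 4"
  have c: "c > 0"
    using m by (simp add: c_def)
  have below: "c * norm x \<le> norm (P x + s *\<^sub>R im x)" for s x
  proof (cases "x = 0")
    case False
    have "(m * norm x)\<^sup>2 \<le> (norm (S x))\<^sup>2"
      using m by (intro power_mono) auto
    also have "\<dots> = norm (ip (P x) x)"
      by (simp add: P_def adjoint_pairD[OF T] norm_ip_self)
    also have "\<dots> \<le> norm (ip (P x) x + \<i> *\<^sub>C (s *\<^sub>R ip x x))"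
      by (intro norm_self_adjoint_le_norm_add_i)
        (simp_all add: P_def adjoint_pairD[OF T] ip_star star_scaleR)
    also have "ip (P x) x + \<i> *\<^sub>C (s *\<^sub>R ip x x) = ip (P x + s *\<^sub>R im x) x"
      by (metis ip_add_left ip_im_left ip_scaleR_left ip_scaleR_right ip_im_right
          minus_minus scaleR_minus_right)
    also have "norm \<dots> \<le> 4 * norm (P x + s *\<^sub>R im x) * norm x"
      by (rule norm_ip_le)
    finally show ?thesis
      using False by (simp add: c_def power2_eq_square field_simps)
  qed simp
  define e where "e = c / 2"
  have e: "0 < e" "e < c"
    using c by (auto simp: e_def)
  have step: "surj P" if "surj (\<lambda>x. P x + (real n * e) *\<^sub>R im x)" for n
    using that
  proof (induction n)
    case (Suc n)
    have "surj (\<lambda>x. (P x + (real (Suc n) * e) *\<^sub>R im x) + (- e) *\<^sub>R im x)"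
      by (rule surj_perturbation[where c = c and r = e])
        (use e below Suc.prems in \<open>auto simp: P_diff im_diff scaleR_right_diff_distrib\<close>)
    also have "(\<lambda>x. (P x + (real (Suc n) * e) *\<^sub>R im x) + (- e) *\<^sub>R im x)
        = (\<lambda>x. P x + (real n * e) *\<^sub>R im x)"
      by (simp add: algebra_simps)
    finally show ?case
      by (rule Suc.IH)
  qed simp
  \<comment> \<open>Beyond the bound \<open>k\<close> of \<open>P\<close> the roles are exchanged:
    \<open>s * im\<close> is surjective and multiplies norms by \<open>s\<close>, and
    \<open>P\<close> is the small perturbation.\<close>
  obtain n where n: "k < real n * e"
    using reals_Archimedean3[OF e(1)] by blast
  have "surj (\<lambda>x. (real n * e) *\<^sub>R im x + P x)"
  proof (rule surj_perturbation[where c = "real n * e" and r = k])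
    show "surj (\<lambda>x. (real n * e) *\<^sub>R im x)"
      unfolding surj_def
    proof
      fix y
      have "(real n * e) *\<^sub>R im (- im ((1 / (real n * e)) *\<^sub>R y)) = y"
        using n k(2) im_diff[of 0] im_diff[of 0 0] by (auto simp: im_im)
      then show "\<exists>x. y = (real n * e) *\<^sub>R im x"
        by metis
    qed
  qed (use n k in \<open>auto simp: P_diff im_diff scaleR_right_diff_distrib mult.commute\<close>)
  then have "surj P"
    by (intro step[of n]) (simp add: add.commute)
  then show ?thesis
    by (simp add: P_def comp_def)
qed

text \<open>Upgrades the norm bound for \<open>S\<close> to one for inner squares. With
  \<open>P = T S\<close> invertible, \<open>V = inv P T\<close> is a left inverse of
  \<open>S\<close> that has an adjoint, and \<open>adjoint_pair_ip_le\<close> for \<open>V\<close>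
  is evaluated at \<open>S y\<close>.\<close>

lemma surj_imp_ip_bounded_below:
  assumes T: "adjoint_pair T S" and "surj T"
  obtains C R where "C > 0" "\<And>y. C *\<^sub>R ip (S y) (S y) - ip y y = ip (R y) (R y)"
proof -
  note S = adjoint_pair_sym[OF T]
  define P where "P = T \<circ> S"
  have bb: "bounded_below S"
    using surj_imp_adjoint_bounded_below assms .
  have P: "adjoint_pair P P"
    unfolding P_def by (rule adjoint_pair_comp[OF T S])
  have PG: "P (inv P y) = y" for y
    by (rule surj_f_inv_f) (simp only: P_def adjoint_bounded_below_imp_surj_comp[OF T bb])
  have "inj P"
  proof (rule injI)
    fix x y assume "P x = P y"
    then have "ip (S (x - y)) (S (x - y)) = 0"
      by (simp add: P_def adjoint_pair_module_map(2)[OF S] ip_diff_left ip_diff_right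
          adjoint_pairD[OF S])
    then have "S (x - y) = 0"
      by (rule ip_definite)
    then have "norm (x - y) = 0"
      using bb unfolding bounded_below_def
      by (metis mult_le_0_iff norm_ge_zero norm_zero order_antisym order_less_le_trans less_irrefl)
    then show "x = y" by simp
  qed
  have G: "adjoint_pair (inv P) (inv P)"
    unfolding adjoint_pair_def by (metis P PG adjoint_pair_def)
  have V: "adjoint_pair (inv P \<circ> T) (S \<circ> inv P)"
    by (rule adjoint_pair_comp[OF G T])
  have VS: "(inv P \<circ> T) (S y) = y" for y
    using inv_f_f[OF \<open>inj P\<close>, of y] by (simp add: P_def)
  obtain C R where "C > 0"
    "\<And>x. C *\<^sub>R ip x x - ip ((inv P \<circ> T) x) ((inv P \<circ> T) x) = ip (R x) (R x)"
    using adjoint_pair_ip_le[OF V] by blast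
  then show thesis
    using that[of C "\<lambda>y. R (S y)"] VS by metis
qed

text \<open>Reads an order relation off an inner square by \<open>ip_positive\<close>, with
  \<open>sqrt r\<close> absorbed into the vector.\<close>

lemma cstar_le_ip:
  assumes "r \<ge> 0" "b - a = r *\<^sub>R ip x x"
  shows "a \<preceq> b"
proof -
  have "b - a = ip (sqrt r *\<^sub>R x) (sqrt r *\<^sub>R x)"
    using assms by (simp add: ip_scaleR_left ip_scaleR_right)
  then show ?thesis
    by (simp add: cstar_le_def ip_positive)
qed

lemma adjointable_endo_module_adjoint:
  assumes "adjointable_endo sm ip T"
  shows "adjoint_pair T (module_adjoint ip T)"
proof -
  obtain S where "adjoint_pair T S"
    using assms by (auto simp: adjointable_def adjoint_pair_def)
  moreover from this have "module_adjoint ip T = S"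
    unfolding module_adjoint_def using adjoint_pair_unique
    by (intro the_equality) (auto simp: adjoint_pair_def)
  ultimately show ?thesis by simp
qed

end

section \<open>The equivalence for tight frames\<close>

theorem theorem2p3:
  fixes smH :: "'a::cstar_algebra \<Rightarrow> 'h::banach \<Rightarrow> 'h" and ipH :: "'h \<Rightarrow> 'h \<Rightarrow> 'a"
    and smK :: "'a \<Rightarrow> 'k::banach \<Rightarrow> 'k" and ipK :: "'k \<Rightarrow> 'k \<Rightarrow> 'a"
    and M :: "'w measure" and Hs :: "'w \<Rightarrow> 'k set"
    and \<Theta> K :: "'h \<Rightarrow> 'h" and \<Upsilon> :: "'w \<Rightarrow> 'h \<Rightarrow> 'k" and \<delta> :: real
  assumes "hilbert_module smH ipH" and "hilbert_module smK ipK"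
    and "\<And>\<xi>. \<xi> \<in> space M \<Longrightarrow> closed_submodule smK (Hs \<xi>)"
    and "adjointable_endo smH ipH \<Theta>" and "adjointable_endo smH ipH K"
    and "tight_cKg_frame \<delta> M smH ipH smK ipK Hs K \<Upsilon>"
    and "\<Theta> \<circ> K = K \<circ> \<Theta>"
    and "bounded_below (module_adjoint ipH K)"
  shows "surj \<Theta> \<longleftrightarrow>
    cKg_frame M smH ipH smK ipK Hs K (\<lambda>\<xi>. \<Upsilon> \<xi> \<circ> module_adjoint ipH \<Theta>)"
proof -
  interpret H: hilbert_module smH ipH by fact
  define Q where "Q = module_adjoint ipH \<Theta>"
  define L where "L = module_adjoint ipH K"
  have \<Theta>: "H.adjoint_pair \<Theta> Q" and K: "H.adjoint_pair K L"
    unfolding Q_def L_def by (intro H.adjointable_endo_module_adjoint assms(4,5))+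
  note Q = H.adjoint_pair_sym[OF \<Theta>] and L = H.adjoint_pair_sym[OF K]
  \<comment> \<open>Both composites are adjoints of the same operator, as \<Theta> and
    \<open>K\<close> commute.\<close>
  have LQ: "L (Q h) = Q (L h)" for h
    using H.adjoint_pair_unique[OF H.adjoint_pair_comp[OF \<Theta> K]] H.adjoint_pair_comp[OF K \<Theta>] assms(7)
    by (metis comp_apply)
  have frame: "cKg_frame M smH ipH smK ipK Hs K \<Upsilon>" and \<delta>: "\<delta> > 0"
    and tight: "\<And>h. has_banach_integral M (\<lambda>\<xi>. ipK (\<Upsilon> \<xi> h) (\<Upsilon> \<xi> h)) (\<delta> *\<^sub>R ipH (L h) (L h))"
    using assms(6) by (auto simp: tight_cKg_frame_def L_def)
  have "surj \<Theta> \<longleftrightarrow> cKg_frame M smH ipH smK ipK Hs K (\<lambda>\<xi>. \<Upsilon> \<xi> \<circ> Q)"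
  proof
    assume surj: "surj \<Theta>"
    obtain C R where C: "C > 0" "\<And>y. C *\<^sub>R ipH (Q y) (Q y) - ipH y y = ipH (R y) (R y)"
      using H.surj_imp_ip_bounded_below[OF \<Theta> surj] by blast
    \<comment> \<open>Requiring \<open>1 / C \<le> D\<close> makes the lower frame constant at most
      the upper one.\<close>
    obtain D S where D: "D > 0" "1 / C \<le> D"
      "\<And>x. D *\<^sub>R ipH x x - ipH ((L \<circ> Q) x) ((L \<circ> Q) x) = ipH (S x) (S x)"
      using H.adjoint_pair_ip_le[OF H.adjoint_pair_comp[OF L Q], of "1 / C"] by blast
    \<comment> \<open>The inequality for \<open>C\<close> at the vector \<open>L h\<close>, once
      \<open>Q\<close> is moved past \<open>L\<close>.\<close>
    have lower: "(\<delta> / C) *\<^sub>R ipH (L h) (L h) \<preceq> \<delta> *\<^sub>R ipH (L (Q h)) (L (Q h))" for h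
    proof (rule H.cstar_le_ip)
      show "\<delta> *\<^sub>R ipH (L (Q h)) (L (Q h)) - (\<delta> / C) *\<^sub>R ipH (L h) (L h)
          = (\<delta> / C) *\<^sub>R ipH (R (L h)) (R (L h))"
        using C(1) by (simp add: LQ scaleR_right_diff_distrib flip: C(2))
    qed (use C(1) \<delta> in simp)
    have upper: "\<delta> *\<^sub>R ipH (L (Q h)) (L (Q h)) \<preceq> (\<delta> * D) *\<^sub>R ipH h h" for h
    proof (rule H.cstar_le_ip)
      show "(\<delta> * D) *\<^sub>R ipH h h - \<delta> *\<^sub>R ipH (L (Q h)) (L (Q h)) = \<delta> *\<^sub>R ipH (S h) (S h)"
        by (simp add: scaleR_right_diff_distrib flip: D(3))
    qed (use \<delta> in simp)
    have AB: "0 < \<delta> / C" "\<delta> / C \<le> \<delta> * D"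
      using C(1) D(2) \<delta> mult_left_mono[OF D(2), of \<delta>] by simp_all
    show "cKg_frame M smH ipH smK ipK Hs K (\<lambda>\<xi>. \<Upsilon> \<xi> \<circ> Q)"
      unfolding cKg_frame_def L_def[symmetric]
    proof (intro conjI ballI allI)
      fix \<xi> assume "\<xi> \<in> space M"
      then have "adjointable smH ipH smK ipK (Hs \<xi>) (\<Upsilon> \<xi>)"
        using frame by (simp add: cKg_frame_def)
      then obtain S where "\<And>x y. \<Upsilon> \<xi> (x + y) = \<Upsilon> \<xi> x + \<Upsilon> \<xi> y"
        "\<And>a x. \<Upsilon> \<xi> (smH a x) = smK a (\<Upsilon> \<xi> x)" "range (\<Upsilon> \<xi>) \<subseteq> Hs \<xi>"
        "\<And>x y. y \<in> Hs \<xi> \<Longrightarrow> ipK (\<Upsilon> \<xi> x) y = ipH x (S y)"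
        unfolding adjointable_def by blast
      then show "adjointable smH ipH smK ipK (Hs \<xi>) (\<Upsilon> \<xi> \<circ> Q)"
        unfolding adjointable_def
        \<comment> \<open>The adjoint of the composite with \<open>Q\<close> is \<Theta> after the
          adjoint \<open>S\<close> on the submodule.\<close>
        by (intro conjI allI exI[of _ "\<lambda>y. \<Theta> (S y)"])
          (auto simp: H.adjoint_pair_module_map[OF Q] H.adjoint_pairD[OF Q])
    next
      show "(\<lambda>\<xi>. (\<Upsilon> \<xi> \<circ> Q) h) \<in> borel_measurable M" for h
        using frame by (simp add: cKg_frame_def)
    next
      have "has_banach_integral M (\<lambda>\<xi>. ipK ((\<Upsilon> \<xi> \<circ> Q) h) ((\<Upsilon> \<xi> \<circ> Q) h))
          (\<delta> *\<^sub>R ipH (L (Q h)) (L (Q h)))" for h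
        using tight[of "Q h"] by simp
      then show "\<exists>A B. 0 < A \<and> A \<le> B \<and> (\<forall>h. \<exists>I.
          has_banach_integral M (\<lambda>\<xi>. ipK ((\<Upsilon> \<xi> \<circ> Q) h) ((\<Upsilon> \<xi> \<circ> Q) h)) I \<and>
          A *\<^sub>R ipH (L h) (L h) \<preceq> I \<and> I \<preceq> B *\<^sub>R ipH h h)"
        using AB lower upper by blast
    qed
  next
    assume "cKg_frame M smH ipH smK ipK Hs K (\<lambda>\<xi>. \<Upsilon> \<xi> \<circ> Q)"
    then obtain A where A: "A > 0" and "\<And>h. \<exists>I.
        has_banach_integral M (\<lambda>\<xi>. ipK (\<Upsilon> \<xi> (Q h)) (\<Upsilon> \<xi> (Q h))) I \<and> A *\<^sub>R ipH (L h) (L h) \<preceq> I"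
      unfolding cKg_frame_def L_def comp_def by blast
    \<comment> \<open>Uniqueness of the integral replaces the unspecified value by the one that
      tightness gives at \<open>Q h\<close>.\<close>
    then have le: "A *\<^sub>R ipH (L h) (L h) \<preceq> \<delta> *\<^sub>R ipH (L (Q h)) (L (Q h))" for h
      using has_banach_integral_unique tight by metis
    obtain m where m: "m > 0" "\<And>x. m * norm x \<le> norm (L x)"
      using assms(8) unfolding bounded_below_def L_def by blast
    obtain k where k: "\<And>x. norm (L x) \<le> norm x * k" "k > 0"
      using bounded_linear.pos_bounded[OF H.adjoint_pair_bounded_linear[OF L]] by metis
    \<comment> \<open>The constant collects three estimates: \<open>L\<close> is bounded below by
      \<open>m\<close>, the frame inequality compares the norms of \<open>L h\<close> and
      \<open>L (Q h)\<close>, and \<open>L\<close> is bounded above by \<open>k\<close>.\<close>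
    have "sqrt (A / \<delta>) * m / k * norm h \<le> norm (Q h)" for h
    proof -
      have "cstar_positive (A *\<^sub>R ipH (L h) (L h))"
        using H.ip_positive[of "sqrt A *\<^sub>R L h"] A by (simp add: H.ip_scaleR_left H.ip_scaleR_right)
      then have "norm (A *\<^sub>R ipH (L h) (L h)) \<le> norm (\<delta> *\<^sub>R ipH (L (Q h)) (L (Q h)))"
        using le by (rule cstar_le_norm_mono)
      then have "A / \<delta> * (norm (L h))\<^sup>2 \<le> (norm (L (Q h)))\<^sup>2"
        using A \<delta> by (simp add: H.norm_ip_self field_simps)
      then have "sqrt (A / \<delta>) * norm (L h) \<le> norm (L (Q h))"
        by (metis norm_ge_zero real_le_rsqrt real_sqrt_abs2 real_sqrt_le_iff real_sqrt_mult
            power2_eq_square abs_norm_cancel)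
      also have "\<dots> \<le> norm (Q h) * k"
        by (rule k)
      finally have "sqrt (A / \<delta>) * norm (L h) \<le> norm (Q h) * k" .
      moreover have "sqrt (A / \<delta>) * (m * norm h) \<le> sqrt (A / \<delta>) * norm (L h)"
        using A \<delta> m(2) by (intro mult_left_mono) auto
      ultimately have "sqrt (A / \<delta>) * (m * norm h) \<le> norm (Q h) * k"
        by linarith
      then show ?thesis
        using k(2) by (simp add: pos_divide_le_eq mult.assoc)
    qed
    then have "bounded_below Q"
      unfolding bounded_below_def using A \<delta> m(1) k(2)
      by (intro exI[of _ "sqrt (A / \<delta>) * m / k"]) simp
    then have "surj (\<Theta> \<circ> Q)"
      by (rule H.adjoint_bounded_below_imp_surj_comp[OF \<Theta>])
    then show "surj \<Theta>"
      unfolding surj_def comp_def by blast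
  qed
  then show ?thesis
    by (simp add: Q_def)
qed

end
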